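(* (i) The inclusion $\overline{P(\mathbb R)}\subset M_2(\mathbb R)\smallsetminus\{0\}$ induces a bijection of $\overline{P(\mathbb R)}$ with the complement in $(M_2(\mathbb R)\smallsetminus\{0\})/\mathbb C^\times$ of the point $\infty$ given by the class of matrices with vanishing second line. (ii) The inclusion $\overline{P(\mathbb A_{\mathbb Q})}\subset M_2(\mathbb A_{\mathbb Q})^\bullet$ induces a morphism of noncommutative spaces (a map of the quotient spaces) $$\mathcal C_{\mathbb Q}=P(\mathbb Q)\backslash\overline{P(\mathbb A_{\mathbb Q})}\;\xrightarrow{\ \theta\ }\;GL_2(\mathbb Q)\backslash M_2(\mathbb A_{\mathbb Q})^\bullet/\mathbb C^\times=\overline{Sh^{\rm nc}(GL_2,\mathbb H^\pm)} .$$
   Context: For a commutative ring $R$, $\overline{P(R)}=\left\{\begin{pmatrix} a&b\\0&1\end{pmatrix}: a,b\in R\right\}\subset M_2(R)$ and $P(R)$ is the group of those matrices with $a$ invertible. $\mathbb A_{\mathbb Q}=\mathbb A_{\mathbb Q,f}\times\mathbb R$ denotes the adeles of $\mathbb Q$ and $M_2(\mathbb A_{\mathbb Q})^\bullet:=M_2(\mathbb A_{\mathbb Q,f})\times(M_2(\mathbb R)\smallsetminus\{0\})$. The groups $P(\mathbb Q)$ and $GL_2(\mathbb Q)$ act by left multiplication (diagonally). $\mathbb C^\times$ is viewed as a subgroup of $GL_2^+(\mathbb R)$ by $a+ib\mapsto\begin{pmatrix} a&b\\-b&a\end{pmatrix}$ and acts by right multiplication at the archimedean place. *)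

theory Defs
  imports "HOL-Algebra.Group_Action" "HOL-Analysis.Analysis"
begin

section \<open>The p-adic absolute value\<close>

definition padic_abs :: "nat \<Rightarrow> rat \<Rightarrow> real" where
  "padic_abs p r =
     (if r = 0 then 0
      else real p powi (int (multiplicity (int p) (snd (quotient_of r)))
                      - int (multiplicity (int p) (fst (quotient_of r)))))"

lemma padic_abs_0 [simp]: "padic_abs p 0 = 0"
  by (simp add: padic_abs_def)

lemma padic_abs_frac:
  assumes p: "prime p" and a: "a \<noteq> 0" and b: "b \<noteq> 0"
  shows "padic_abs p (of_int a / of_int b) =
    real p powi (int (multiplicity (int p) b) - int (multiplicity (int p) a))"
proof -
  define r :: rat where "r = of_int a / of_int b"
  obtain c d where cd: "quotient_of r = (c, d)" by (cases "quotient_of r")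
  have d: "d > 0" using cd quotient_of_denom_pos by blast
  have r: "r = of_int c / of_int d" using cd quotient_of_div by blast
  have r0: "r \<noteq> 0" using a b by (simp add: r_def)
  have c0: "c \<noteq> 0" using r r0 by auto
  have "(of_int c :: rat) * of_int b = of_int a * of_int d"
    using r b d unfolding r_def by (simp add: field_simps)
  hence eq: "c * b = a * d" by (metis of_int_eq_iff of_int_mult)
  have pe: "prime_elem (int p)" using p by simp
  have "multiplicity (int p) c + multiplicity (int p) b
      = multiplicity (int p) a + multiplicity (int p) d"
    using arg_cong[OF eq, of "multiplicity (int p)"] a b c0 d
    by (simp add: prime_elem_multiplicity_mult_distrib[OF pe])
  hence "int (multiplicity (int p) d) - int (multiplicity (int p) c)
      = int (multiplicity (int p) b) - int (multiplicity (int p) a)" by linarith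
  thus ?thesis using r0 cd unfolding padic_abs_def r_def[symmetric] by simp
qed

lemma padic_abs_nonneg [simp]: "padic_abs p r \<ge> 0"
  by (simp add: padic_abs_def)

lemma padic_abs_1 [simp]: "prime p \<Longrightarrow> padic_abs p 1 = 1"
  using padic_abs_frac[of p 1 1] by simp

lemma rat_frac:
  obtains a b where "(r::rat) = of_int a / of_int b" "b \<noteq> 0"
proof (cases "quotient_of r")
  case (Pair a b)
  then show ?thesis
    using that[of a b] quotient_of_div[OF Pair] quotient_of_denom_pos[OF Pair] by simp
qed

lemma rat_common_denom:
  obtains a b m where "(r::rat) = of_int a / of_int m" "(s::rat) = of_int b / of_int m" "m \<noteq> 0"
proof -
  obtain a b where r: "r = of_int a / of_int b" "b \<noteq> 0"
    by (rule rat_frac[of r])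
  obtain c d where s: "s = of_int c / of_int d" "d \<noteq> 0"
    by (rule rat_frac[of s])
  have "r = of_int (a * d) / of_int (b * d)" "s = of_int (c * b) / of_int (b * d)" "b * d \<noteq> 0"
    using r s by auto
  thus ?thesis using that by blast
qed

lemma padic_abs_minus [simp]: "prime p \<Longrightarrow> padic_abs p (- r) = padic_abs p r"
proof (cases "r = 0")
  case False
  assume p: "prime p"
  obtain a b where r: "r = of_int a / of_int b" "b \<noteq> 0" by (rule rat_frac[of r])
  then have a: "a \<noteq> 0" "- a \<noteq> 0" using False by auto
  have m: "multiplicity (int p) (- a) = multiplicity (int p) a"
    by (rule multiplicity_times_unit_right[of "-1" "int p" a, simplified])
  have r': "- r = of_int (- a) / of_int b" using r by simp
  show ?thesis
    unfolding r' padic_abs_frac[OF p a(2) r(2)] m unfolding r(1) padic_abs_frac[OF p a(1) r(2)] ..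
qed simp

lemma padic_abs_mult:
  assumes p: "prime p" shows "padic_abs p (r * s) = padic_abs p r * padic_abs p s"
proof (cases "r = 0 \<or> s = 0")
  case False
  obtain a b m where r: "r = of_int a / of_int m" "s = of_int b / of_int m" "m \<noteq> 0"
    by (rule rat_common_denom[of r s])
  have ab: "a \<noteq> 0" "b \<noteq> 0" using False r by auto
  have rs: "r * s = of_int (a * b) / of_int (m * m)" using r by simp
  have pe: "prime_elem (int p)" using p by simp
  have p0: "real p \<noteq> 0" using p by (simp add: prime_gt_0_nat)
  have abm: "a * b \<noteq> 0" "m * m \<noteq> 0" using ab r(3) by auto
  have e: "int (multiplicity (int p) (m * m)) - int (multiplicity (int p) (a * b)) =
      (int (multiplicity (int p) m) - int (multiplicity (int p) a))
    + (int (multiplicity (int p) m) - int (multiplicity (int p) b))"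
    using ab r(3) by (simp add: prime_elem_multiplicity_mult_distrib[OF pe])
  have "padic_abs p (r * s) = real p powi
      (int (multiplicity (int p) (m * m)) - int (multiplicity (int p) (a * b)))"
    unfolding rs by (rule padic_abs_frac[OF p abm])
  also have "\<dots> = padic_abs p r * padic_abs p s"
    unfolding e r(1) r(2) padic_abs_frac[OF p ab(1) r(3)] padic_abs_frac[OF p ab(2) r(3)]
    by (rule power_int_add) (use p0 in simp)
  finally show ?thesis .
qed auto

lemma padic_abs_add:
  assumes p: "prime p" shows "padic_abs p (r + s) \<le> max (padic_abs p r) (padic_abs p s)"
proof (cases "r = 0 \<or> s = 0 \<or> r + s = 0")
  case True
  then show ?thesis by (auto simp: max_def)
next
  case False
  obtain a b m where r: "r = of_int a / of_int m" "s = of_int b / of_int m" "m \<noteq> 0"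
    by (rule rat_common_denom[of r s])
  have rs: "r + s = of_int (a + b) / of_int m" using r by (simp add: add_divide_distrib)
  have ab: "a \<noteq> 0" "b \<noteq> 0" "a + b \<noteq> 0" using False r rs by auto
  let ?k = "\<lambda>x. multiplicity (int p) x"
  have "\<not> is_unit (int p)" using p by auto
  have "int p ^ min (?k a) (?k b) dvd a + b"
    by (intro dvd_add multiplicity_dvd') auto
  hence "min (?k a) (?k b) \<le> ?k (a + b)"
    using ab \<open>\<not> is_unit (int p)\<close> by (intro multiplicity_geI) auto
  hence "int (?k m) - int (?k (a + b)) \<le> int (?k m) - int (?k a)
       \<or> int (?k m) - int (?k (a + b)) \<le> int (?k m) - int (?k b)" by linarith
  moreover have "real p \<ge> 1" using p prime_ge_1_nat by fastforce
  ultimately show ?thesis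
    unfolding rs unfolding r(1) r(2) padic_abs_frac[OF p ab(1) r(3)] padic_abs_frac[OF p ab(2) r(3)]
      padic_abs_frac[OF p ab(3) r(3)] le_max_iff_disj
    using power_int_increasing by blast
qed

lemma padic_abs_diff_commute: "prime p \<Longrightarrow> padic_abs p (r - s) = padic_abs p (s - r)"
  by (metis minus_diff_eq padic_abs_minus)

lemma padic_abs_add_le:
  assumes p: "prime p" shows "padic_abs p (r + s) \<le> padic_abs p r + padic_abs p s"
  using padic_abs_add[OF p, of r s] padic_abs_nonneg[of p r] padic_abs_nonneg[of p s] by linarith

lemma padic_abs_triangle:
  assumes p: "prime p" shows "\<bar>padic_abs p r - padic_abs p s\<bar> \<le> padic_abs p (r - s)"
  using padic_abs_add_le[OF p, of "r - s" s] padic_abs_add_le[OF p, of "s - r" r]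
    padic_abs_diff_commute[OF p, of r s] by simp

section \<open>The fields of p-adic numbers, as completions of the rationals\<close>

definition padic_Cauchy :: "nat \<Rightarrow> (nat \<Rightarrow> rat) \<Rightarrow> bool" where
  "padic_Cauchy p X \<longleftrightarrow> (\<forall>e>0. \<exists>N. \<forall>m\<ge>N. \<forall>n\<ge>N. padic_abs p (X m - X n) < e)"

definition padic_null :: "nat \<Rightarrow> (nat \<Rightarrow> rat) \<Rightarrow> bool" where
  "padic_null p X \<longleftrightarrow> (\<lambda>n. padic_abs p (X n)) \<longlonglongrightarrow> 0"

lemma padic_Cauchy_const [simp]: "padic_Cauchy p (\<lambda>_. r)"
  by (simp add: padic_Cauchy_def)

lemma padic_Cauchy_real:
  assumes p: "prime p" and X: "padic_Cauchy p X"
  shows "convergent (\<lambda>n. padic_abs p (X n))"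
  unfolding Cauchy_convergent_iff[symmetric]
proof (rule metric_CauchyI)
  fix e :: real assume "e > 0"
  then obtain N where "\<forall>m\<ge>N. \<forall>n\<ge>N. padic_abs p (X m - X n) < e"
    using X unfolding padic_Cauchy_def by blast
  then show "\<exists>M. \<forall>m\<ge>M. \<forall>n\<ge>M. dist (padic_abs p (X m)) (padic_abs p (X n)) < e"
    unfolding dist_real_def by (meson p padic_abs_triangle le_less_trans)
qed

lemma padic_Cauchy_bounded:
  assumes p: "prime p" and X: "padic_Cauchy p X"
  obtains B where "B > 0" "\<And>n. padic_abs p (X n) \<le> B"
proof -
  have "Bseq (\<lambda>n. padic_abs p (X n))"
    using padic_Cauchy_real[OF p X] convergent_imp_Bseq by blast
  then obtain K where "K > 0" "\<forall>n. norm (padic_abs p (X n)) \<le> K" by (rule BseqE)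
  then show ?thesis using that[of K] by auto
qed

lemma padic_Cauchy_add:
  assumes p: "prime p" and X: "padic_Cauchy p X" and Y: "padic_Cauchy p Y"
  shows "padic_Cauchy p (\<lambda>n. X n + Y n)"
  unfolding padic_Cauchy_def
proof (intro allI impI)
  fix e :: real assume e: "e > 0"
  obtain N where N: "\<forall>m\<ge>N. \<forall>n\<ge>N. padic_abs p (X m - X n) < e"
    using X e unfolding padic_Cauchy_def by blast
  obtain M where M: "\<forall>m\<ge>M. \<forall>n\<ge>M. padic_abs p (Y m - Y n) < e"
    using Y e unfolding padic_Cauchy_def by blast
  have "padic_abs p (X m + Y m - (X n + Y n)) < e" if "m \<ge> max M N" "n \<ge> max M N" for m n
  proof -
    have "X m + Y m - (X n + Y n) = (X m - X n) + (Y m - Y n)" by simp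
    moreover have "padic_abs p (X m - X n) < e" "padic_abs p (Y m - Y n) < e"
      using N M that by auto
    ultimately show ?thesis
      using padic_abs_add[OF p, of "X m - X n" "Y m - Y n"] by (metis le_less_trans max_less_iff_conj)
  qed
  then show "\<exists>N. \<forall>m\<ge>N. \<forall>n\<ge>N. padic_abs p (X m + Y m - (X n + Y n)) < e" by blast
qed

lemma padic_Cauchy_uminus:
  assumes p: "prime p" and X: "padic_Cauchy p X"
  shows "padic_Cauchy p (\<lambda>n. - X n)"
proof -
  have "padic_abs p (- X m - (- X n)) = padic_abs p (X m - X n)" for m n
    using padic_abs_diff_commute[OF p, of "X m" "X n"] by simp
  then show ?thesis using X unfolding padic_Cauchy_def by simp
qed

lemma padic_Cauchy_diff:
  assumes p: "prime p" and X: "padic_Cauchy p X" and Y: "padic_Cauchy p Y"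
  shows "padic_Cauchy p (\<lambda>n. X n - Y n)"
  using padic_Cauchy_add[OF p X padic_Cauchy_uminus[OF p Y]] by simp

lemma padic_Cauchy_mult:
  assumes p: "prime p" and X: "padic_Cauchy p X" and Y: "padic_Cauchy p Y"
  shows "padic_Cauchy p (\<lambda>n. X n * Y n)"
  unfolding padic_Cauchy_def
proof (intro allI impI)
  fix e :: real assume e: "e > 0"
  obtain A where A: "A > 0" "\<And>n. padic_abs p (X n) \<le> A" using padic_Cauchy_bounded[OF p X] by blast
  obtain B where B: "B > 0" "\<And>n. padic_abs p (Y n) \<le> B" using padic_Cauchy_bounded[OF p Y] by blast
  obtain N where N: "\<forall>m\<ge>N. \<forall>n\<ge>N. padic_abs p (X m - X n) < e / B"
    using X e B unfolding padic_Cauchy_def by (meson divide_pos_pos)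
  obtain M where M: "\<forall>m\<ge>M. \<forall>n\<ge>M. padic_abs p (Y m - Y n) < e / A"
    using Y e A unfolding padic_Cauchy_def by (meson divide_pos_pos)
  have "padic_abs p (X m * Y m - X n * Y n) < e" if mn: "m \<ge> max M N" "n \<ge> max M N" for m n
  proof -
    have eq: "X m * Y m - X n * Y n = X m * (Y m - Y n) + (X m - X n) * Y n"
      by (simp add: algebra_simps)
    have "padic_abs p (X m) * padic_abs p (Y m - Y n) \<le> A * padic_abs p (Y m - Y n)"
      using A by (simp add: mult_right_mono)
    moreover have "A * padic_abs p (Y m - Y n) < e"
      using M mn A(1) by (simp add: field_simps)
    moreover have "padic_abs p (X m - X n) * padic_abs p (Y n) \<le> padic_abs p (X m - X n) * B"
      using B by (simp add: mult_left_mono)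
    moreover have "padic_abs p (X m - X n) * B < e"
      using N mn B(1) by (simp add: field_simps)
    ultimately show ?thesis
      using padic_abs_add[OF p, of "X m * (Y m - Y n)" "(X m - X n) * Y n"]
      unfolding eq padic_abs_mult[OF p] by linarith
  qed
  then show "\<exists>N. \<forall>m\<ge>N. \<forall>n\<ge>N. padic_abs p (X m * Y m - X n * Y n) < e" by blast
qed

lemma padic_null_0 [simp]: "padic_null p (\<lambda>_. 0)"
  by (simp add: padic_null_def)

lemma padic_null_add:
  assumes p: "prime p" and X: "padic_null p X" and Y: "padic_null p Y"
  shows "padic_null p (\<lambda>n. X n + Y n)"
proof -
  have "(\<lambda>n. padic_abs p (X n) + padic_abs p (Y n)) \<longlonglongrightarrow> 0"
    using tendsto_add[OF X[unfolded padic_null_def] Y[unfolded padic_null_def]] by simp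
  then show ?thesis unfolding padic_null_def
    by (rule Lim_null_comparison[rotated]) (simp add: padic_abs_add_le[OF p])
qed

lemma padic_null_uminus:
  "prime p \<Longrightarrow> padic_null p X \<Longrightarrow> padic_null p (\<lambda>n. - X n)"
  by (simp add: padic_null_def)

lemma padic_null_mult:
  assumes p: "prime p" and X: "padic_null p X" and Y: "padic_Cauchy p Y"
  shows "padic_null p (\<lambda>n. X n * Y n)"
proof -
  obtain B where B: "B > 0" "\<And>n. padic_abs p (Y n) \<le> B" using padic_Cauchy_bounded[OF p Y] by blast
  have "(\<lambda>n. padic_abs p (X n) * B) \<longlonglongrightarrow> 0"
    using tendsto_mult_right[OF X[unfolded padic_null_def], of B] by simp
  then show ?thesis unfolding padic_null_def
    by (rule Lim_null_comparison[rotated]) (simp add: padic_abs_mult[OF p] mult_left_mono B)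
qed

text \<open>
  The type \<open>padics\<close> is the product over all primes $p$ of the completions $\mathbf{Q}_p$.
  An element is represented by a family of rational sequences whose member at each prime $p$ is
  $p$-adically Cauchy; two families are identified if for each prime $p$ their difference tends
  to $0$ $p$-adically. Members at indices that are not prime are irrelevant.
\<close>

definition padics_rel :: "(nat \<Rightarrow> nat \<Rightarrow> rat) \<Rightarrow> (nat \<Rightarrow> nat \<Rightarrow> rat) \<Rightarrow> bool" where
  "padics_rel X Y \<longleftrightarrow> (\<forall>p. prime p \<longrightarrow>
     padic_Cauchy p (X p) \<and> padic_Cauchy p (Y p) \<and> padic_null p (\<lambda>n. X p n - Y p n))"

lemma part_equivp_padics_rel: "part_equivp padics_rel"
proof (rule part_equivpI)
  show "\<exists>x. padics_rel x x"
    by (rule exI[of _ "\<lambda>_ _. 0"]) (simp add: padics_rel_def)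
  show "symp padics_rel"
  proof (rule sympI)
    fix X Y assume XY: "padics_rel X Y"
    show "padics_rel Y X" unfolding padics_rel_def
    proof (intro allI impI conjI)
      fix p :: nat assume p: "prime p"
      have "padic_null p (\<lambda>n. - (X p n - Y p n))"
        using XY p unfolding padics_rel_def by (intro padic_null_uminus) auto
      then show "padic_null p (\<lambda>n. Y p n - X p n)" by simp
    qed (use XY in \<open>auto simp: padics_rel_def\<close>)
  qed
  show "transp padics_rel"
  proof (rule transpI)
    fix X Y Z assume XY: "padics_rel X Y" and YZ: "padics_rel Y Z"
    show "padics_rel X Z" unfolding padics_rel_def
    proof (intro allI impI conjI)
      fix p :: nat assume p: "prime p"
      have "padic_null p (\<lambda>n. (X p n - Y p n) + (Y p n - Z p n))"
        using XY YZ p unfolding padics_rel_def by (intro padic_null_add) auto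
      then show "padic_null p (\<lambda>n. X p n - Z p n)" by simp
    qed (use XY YZ in \<open>auto simp: padics_rel_def\<close>)
  qed
qed

quotient_type padics = "nat \<Rightarrow> nat \<Rightarrow> rat" / partial: padics_rel
  by (rule part_equivp_padics_rel)

lemma padics_rel_eqI: "padics_rel X X \<Longrightarrow> X = Y \<Longrightarrow> padics_rel X Y"
  by simp

lemma padics_rel_closed:
  "padics_rel (\<lambda>_ _. q) (\<lambda>_ _. q)"
  "padics_rel X X \<Longrightarrow> padics_rel (\<lambda>p n. - X p n) (\<lambda>p n. - X p n)"
  "padics_rel X X \<Longrightarrow> padics_rel Y Y \<Longrightarrow>
     padics_rel (\<lambda>p n. X p n + Y p n) (\<lambda>p n. X p n + Y p n)"
  "padics_rel X X \<Longrightarrow> padics_rel Y Y \<Longrightarrow>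
     padics_rel (\<lambda>p n. X p n * Y p n) (\<lambda>p n. X p n * Y p n)"
  by (simp_all add: padics_rel_def padic_Cauchy_uminus padic_Cauchy_add padic_Cauchy_mult)

instantiation padics :: comm_ring_1
begin

lift_definition zero_padics :: padics is "\<lambda>_ _. 0" by (simp add: padics_rel_def)

lift_definition one_padics :: padics is "\<lambda>_ _. 1" by (simp add: padics_rel_def)

lift_definition plus_padics :: "padics \<Rightarrow> padics \<Rightarrow> padics" is "\<lambda>X Y p n. X p n + Y p n"
  unfolding padics_rel_def
proof (intro allI impI conjI)
  fix X X' Y Y' and p :: nat
  assume X: "\<forall>p. prime p \<longrightarrow> padic_Cauchy p (X p) \<and> padic_Cauchy p (X' p) \<and>
      padic_null p (\<lambda>n. X p n - X' p n)"
    and Y: "\<forall>p. prime p \<longrightarrow> padic_Cauchy p (Y p) \<and> padic_Cauchy p (Y' p) \<and>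
      padic_null p (\<lambda>n. Y p n - Y' p n)" and p: "prime p"
  show "padic_Cauchy p (\<lambda>n. X p n + Y p n)" "padic_Cauchy p (\<lambda>n. X' p n + Y' p n)"
    using X Y p padic_Cauchy_add by blast+
  have "padic_null p (\<lambda>n. (X p n - X' p n) + (Y p n - Y' p n))"
    using X Y p padic_null_add by blast
  then show "padic_null p (\<lambda>n. X p n + Y p n - (X' p n + Y' p n))"
    by (simp add: algebra_simps)
qed

lift_definition uminus_padics :: "padics \<Rightarrow> padics" is "\<lambda>X p n. - X p n"
  unfolding padics_rel_def
proof (intro allI impI conjI)
  fix X X' and p :: nat
  assume X: "\<forall>p. prime p \<longrightarrow> padic_Cauchy p (X p) \<and> padic_Cauchy p (X' p) \<and>
      padic_null p (\<lambda>n. X p n - X' p n)" and p: "prime p"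
  show "padic_Cauchy p (\<lambda>n. - X p n)" "padic_Cauchy p (\<lambda>n. - X' p n)"
    using X p padic_Cauchy_uminus by blast+
  have "padic_null p (\<lambda>n. - (X p n - X' p n))"
    using X p by (intro padic_null_uminus) auto
  then show "padic_null p (\<lambda>n. - X p n - - X' p n)"
    by (simp add: algebra_simps)
qed

lift_definition times_padics :: "padics \<Rightarrow> padics \<Rightarrow> padics" is "\<lambda>X Y p n. X p n * Y p n"
  unfolding padics_rel_def
proof (intro allI impI conjI)
  fix X X' Y Y' and p :: nat
  assume X: "\<forall>p. prime p \<longrightarrow> padic_Cauchy p (X p) \<and> padic_Cauchy p (X' p) \<and>
      padic_null p (\<lambda>n. X p n - X' p n)"
    and Y: "\<forall>p. prime p \<longrightarrow> padic_Cauchy p (Y p) \<and> padic_Cauchy p (Y' p) \<and>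
      padic_null p (\<lambda>n. Y p n - Y' p n)" and p: "prime p"
  show "padic_Cauchy p (\<lambda>n. X p n * Y p n)" "padic_Cauchy p (\<lambda>n. X' p n * Y' p n)"
    using X Y p padic_Cauchy_mult by blast+
  have "padic_null p (\<lambda>n. (X p n - X' p n) * Y p n)" "padic_null p (\<lambda>n. (Y p n - Y' p n) * X' p n)"
    using X Y p padic_null_mult by blast+
  then have "padic_null p (\<lambda>n. (X p n - X' p n) * Y p n + (Y p n - Y' p n) * X' p n)"
    using p padic_null_add by blast
  then show "padic_null p (\<lambda>n. X p n * Y p n - X' p n * Y' p n)"
    by (simp add: algebra_simps)
qed

definition minus_padics :: "padics \<Rightarrow> padics \<Rightarrow> padics" where
  "minus_padics x y = x + - y"

instance
proof
  show "(0::padics) \<noteq> 1"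
  proof transfer
    have "\<not> padic_null 2 (\<lambda>n. 0 - 1)"
      unfolding padic_null_def by (simp add: LIMSEQ_const_iff)
    then show "\<not> padics_rel (\<lambda>_ _. 0) (\<lambda>_ _. 1)"
      unfolding padics_rel_def using two_is_prime_nat by blast
  qed
  show "x - y = x + - y" for x y :: padics
    by (rule minus_padics_def)
qed (transfer, rule padics_rel_eqI, (rule padics_rel_closed | assumption)+,
  simp add: fun_eq_iff algebra_simps)+

end

lift_definition padics_of_rat :: "rat \<Rightarrow> padics" is "\<lambda>q _ _. q"
  by (simp add: padics_rel_def)

text \<open>The absolute value at the prime $p$ of the component at $p$.\<close>

lift_definition padics_abs :: "nat \<Rightarrow> padics \<Rightarrow> real" is
  "\<lambda>p X. if prime p then lim (\<lambda>n. padic_abs p (X p n)) else 0"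
proof -
  fix p :: nat and X Y :: "nat \<Rightarrow> nat \<Rightarrow> rat"
  assume XY: "padics_rel X Y"
  have "lim (\<lambda>n. padic_abs p (X p n)) = lim (\<lambda>n. padic_abs p (Y p n))" if p: "prime p"
  proof -
    have null: "(\<lambda>n. padic_abs p (X p n - Y p n)) \<longlonglongrightarrow> 0"
      and X: "padic_Cauchy p (X p)" and Y: "padic_Cauchy p (Y p)"
      using XY p unfolding padics_rel_def padic_null_def by auto
    have d: "(\<lambda>n. padic_abs p (X p n) - padic_abs p (Y p n)) \<longlonglongrightarrow> 0"
      by (rule Lim_null_comparison[OF _ null]) (simp add: padic_abs_triangle[OF p])
    obtain L where L: "(\<lambda>n. padic_abs p (Y p n)) \<longlonglongrightarrow> L"
      using padic_Cauchy_real[OF p Y] convergent_def by blast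
    have "(\<lambda>n. padic_abs p (X p n)) \<longlonglongrightarrow> L"
      using tendsto_add[OF d L] by simp
    with L show ?thesis by (simp add: limI)
  qed
  then show "(if prime p then lim (\<lambda>n. padic_abs p (X p n)) else 0) =
    (if prime p then lim (\<lambda>n. padic_abs p (Y p n)) else 0)" by simp
qed

lemma padics_abs_lim:
  assumes p: "prime p" and X: "padics_rel X X"
  shows "(\<lambda>n. padic_abs p (X p n)) \<longlonglongrightarrow> lim (\<lambda>n. padic_abs p (X p n))"
  using X p unfolding padics_rel_def convergent_LIMSEQ_iff[symmetric]
  by (intro padic_Cauchy_real) auto

lemma padics_abs_of_rat: "prime p \<Longrightarrow> padics_abs p (padics_of_rat q) = padic_abs p q"
  by transfer (simp add: limI)

lemma padics_abs_add: "padics_abs p (x + y) \<le> max (padics_abs p x) (padics_abs p y)"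
proof (transfer, goal_cases)
  case (1 p X Y)
  show ?case
  proof (cases "prime p")
    case p: True
    have XY: "padics_rel (\<lambda>p n. X p n + Y p n) (\<lambda>p n. X p n + Y p n)"
      using 1 padic_Cauchy_add unfolding padics_rel_def by fastforce
    show ?thesis
      using LIMSEQ_le[OF padics_abs_lim[OF p XY]
          tendsto_max[OF padics_abs_lim[OF p 1(1)] padics_abs_lim[OF p 1(2)]]]
        padic_abs_add[OF p] p by auto
  qed simp
qed

lemma padics_abs_mult: "padics_abs p (x * y) = padics_abs p x * padics_abs p y"
proof (transfer, goal_cases)
  case (1 p X Y)
  show ?case
  proof (cases "prime p")
    case p: True
    show ?thesis
      using tendsto_mult[OF padics_abs_lim[OF p 1(1)] padics_abs_lim[OF p 1(2)]] p
      by (simp add: padic_abs_mult[OF p] limI)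
  qed simp
qed

lemma padics_abs_minus [simp]: "padics_abs p (- x) = padics_abs p x"
  by transfer (simp cong: if_cong)

lemma padics_abs_diff: "padics_abs p (x - y) \<le> max (padics_abs p x) (padics_abs p y)"
  using padics_abs_add[of p x "- y"] by simp

lemma padics_abs_nonneg [simp]: "padics_abs p x \<ge> 0"
proof (transfer, goal_cases)
  case (1 p X)
  show ?case
    using LIMSEQ_le_const[OF padics_abs_lim[OF _ 1, of p]] by auto
qed

lemma padics_of_rat_simps:
  "padics_of_rat 0 = 0" "padics_of_rat 1 = 1"
  "padics_of_rat (q + r) = padics_of_rat q + padics_of_rat r"
  "padics_of_rat (q * r) = padics_of_rat q * padics_of_rat r"
  by (transfer; simp add: padics_rel_def)+

lemma padics_abs_0 [simp]: "padics_abs p 0 = 0"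
  by transfer (simp add: limI)

lemma padics_abs_1 [simp]: "prime p \<Longrightarrow> padics_abs p 1 = 1"
  by transfer (simp add: limI)

section \<open>Adeles\<close>

text \<open>The ring of finite adeles is the restricted product of the $\mathbf{Q}_p$ with respect
  to the $\mathbf{Z}_p$, the latter being the elements of absolute value at most $1$.\<close>

typedef fin_adele = "{x :: padics. finite {p. prime p \<and> \<not> padics_abs p x \<le> 1}}"
  by (rule exI[of _ 0]) simp

lemma fin_adele_aux:
  assumes "finite {p. prime p \<and> \<not> padics_abs p x \<le> 1}"
    and "finite {p. prime p \<and> \<not> padics_abs p y \<le> 1}"
    and le: "\<And>p. padics_abs p x \<le> 1 \<Longrightarrow> padics_abs p y \<le> 1 \<Longrightarrow> padics_abs p z \<le> 1"
  shows "finite {p. prime p \<and> \<not> padics_abs p z \<le> 1}"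
proof (rule finite_subset)
  show "{p. prime p \<and> \<not> padics_abs p z \<le> 1} \<subseteq>
    {p. prime p \<and> \<not> padics_abs p x \<le> 1} \<union> {p. prime p \<and> \<not> padics_abs p y \<le> 1}"
    using le by blast
qed (use assms in simp)

setup_lifting type_definition_fin_adele

instantiation fin_adele :: comm_ring_1
begin

lift_definition zero_fin_adele :: fin_adele is 0 by simp

lift_definition one_fin_adele :: fin_adele is 1
proof -
  have "{p. prime p \<and> \<not> padics_abs p 1 \<le> 1} = {}" by auto
  then show "finite {p. prime p \<and> \<not> padics_abs p 1 \<le> 1}" by (simp only: finite.emptyI)
qed

lift_definition plus_fin_adele :: "fin_adele \<Rightarrow> fin_adele \<Rightarrow> fin_adele" is "(+)"
  subgoal for x y
    by (rule fin_adele_aux[of x y], assumption, assumption,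
        rule order_trans[OF padics_abs_add], simp)
  done

lift_definition uminus_fin_adele :: "fin_adele \<Rightarrow> fin_adele" is uminus by simp

lift_definition minus_fin_adele :: "fin_adele \<Rightarrow> fin_adele \<Rightarrow> fin_adele" is "(-)"
  subgoal for x y
    by (rule fin_adele_aux[of x y], assumption, assumption,
        rule order_trans[OF padics_abs_diff], simp)
  done

lift_definition times_fin_adele :: "fin_adele \<Rightarrow> fin_adele \<Rightarrow> fin_adele" is "(*)"
  subgoal for x y
    by (rule fin_adele_aux[of x y]) (auto simp: padics_abs_mult mult_le_one)
  done

instance
  by standard (transfer; simp add: algebra_simps)+

end

lift_definition fin_adele_of_rat :: "rat \<Rightarrow> fin_adele" is padics_of_rat
proof -
  fix q :: rat
  obtain a b where q: "q = of_int a / of_int b" "b \<noteq> 0" by (rule rat_frac[of q])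
  have "{p. prime p \<and> \<not> padics_abs p (padics_of_rat q) \<le> 1} \<subseteq> {p. int p dvd b}"
  proof (clarsimp, rule ccontr)
    fix p :: nat assume p: "prime p" and *: "\<not> padics_abs p (padics_of_rat q) \<le> 1"
      and "\<not> int p dvd b"
    then have m: "multiplicity (int p) b = 0" by (simp add: not_dvd_imp_multiplicity_0)
    have a: "a \<noteq> 0" using * q by (auto simp: padics_abs_of_rat[OF p])
    have "padic_abs p q \<le> 1"
    proof -
      have "padic_abs p q = inverse (real p ^ multiplicity (int p) a)"
        using padic_abs_frac[OF p a q(2)] m q(1) by (simp add: power_int_minus)
      moreover have "1 \<le> real p ^ multiplicity (int p) a"
        using prime_ge_1_nat[OF p] by (intro one_le_power) simp
      ultimately show ?thesis by (simp add: inverse_le_1_iff)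
    qed
    then show False using * by (simp add: padics_abs_of_rat[OF p])
  qed
  moreover have "finite {p. int p dvd b}"
  proof -
    have "{p. int p dvd b} \<subseteq> {p. p dvd nat \<bar>b\<bar>}" by (auto simp: nat_dvd_iff int_dvd_int_iff[symmetric])
    then show ?thesis using q(2) finite_subset finite_divisors_nat by (metis zero_less_abs_iff zero_less_nat_eq)
  qed
  ultimately show "finite {p. prime p \<and> \<not> padics_abs p (padics_of_rat q) \<le> 1}"
    using finite_subset by blast
qed

lift_definition fin_adele_abs :: "nat \<Rightarrow> fin_adele \<Rightarrow> real" is padics_abs .

text \<open>
  The restricted product topology: a base of neighbourhoods of $x$ is given by the sets
  $\prod_{p \in S} \{y : |y - x|_p < e\} \times \prod_{p \notin S} (x_p + \mathbf{Z}_p)$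
  with $S$ a finite set of primes and $e > 0$; note that $x_p + \mathbf{Z}_p = \mathbf{Z}_p$ for
  almost all $p$.
\<close>

instantiation fin_adele :: topological_space
begin

definition open_fin_adele :: "fin_adele set \<Rightarrow> bool" where
  "open_fin_adele U \<longleftrightarrow> (\<forall>x\<in>U. \<exists>S e. finite S \<and> S \<subseteq> {p. prime p} \<and> e > 0 \<and>
     {y. (\<forall>p\<in>S. fin_adele_abs p (y - x) < e) \<and>
         (\<forall>p. prime p \<and> p \<notin> S \<longrightarrow> fin_adele_abs p (y - x) \<le> 1)} \<subseteq> U)"

instance
proof
  show "open (UNIV :: fin_adele set)"
    unfolding open_fin_adele_def
    by (intro ballI exI[of _ "{}"] exI[of _ "1::real"]) simp
next
  fix U V :: "fin_adele set" assume U: "open U" and V: "open V"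
  show "open (U \<inter> V)" unfolding open_fin_adele_def
  proof
    fix x assume x: "x \<in> U \<inter> V"
    let ?N = "\<lambda>S e. {y. (\<forall>p\<in>S. fin_adele_abs p (y - x) < e) \<and>
         (\<forall>p. prime p \<and> p \<notin> S \<longrightarrow> fin_adele_abs p (y - x) \<le> 1)}"
    from U x obtain S d where S: "finite S" "S \<subseteq> {p. prime p}" "d > 0" "?N S d \<subseteq> U"
      unfolding open_fin_adele_def by (elim IntE) (drule (1) bspec, elim exE conjE, rule that)
    from V x obtain T e where T: "finite T" "T \<subseteq> {p. prime p}" "e > 0" "?N T e \<subseteq> V"
      unfolding open_fin_adele_def by (elim IntE) (drule (1) bspec, elim exE conjE, rule that)
    let ?e = "min 1 (min d e)"
    have le1: "fin_adele_abs p (y - x) \<le> 1" if y: "y \<in> ?N (S \<union> T) ?e" and p: "prime p" for p y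
    proof (cases "p \<in> S \<union> T")
      case True
      then have "fin_adele_abs p (y - x) < ?e" using y by blast
      then show ?thesis by simp
    next
      case False
      then show ?thesis using y p by blast
    qed
    have lt: "fin_adele_abs p (y - x) < min d e" if "y \<in> ?N (S \<union> T) ?e" "p \<in> S \<union> T" for p y
    proof -
      have "fin_adele_abs p (y - x) < ?e" using that by blast
      then show ?thesis by simp
    qed
    have "?N (S \<union> T) ?e \<subseteq> ?N S d"
    proof
      fix y assume y: "y \<in> ?N (S \<union> T) ?e"
      show "y \<in> ?N S d" using le1[OF y] lt[OF y] by simp
    qed
    moreover have "?N (S \<union> T) ?e \<subseteq> ?N T e"
    proof
      fix y assume y: "y \<in> ?N (S \<union> T) ?e"
      show "y \<in> ?N T e" using le1[OF y] lt[OF y] by simp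
    qed
    ultimately have sub: "?N (S \<union> T) ?e \<subseteq> U \<inter> V" using S(4) T(4) by (meson Int_greatest order_trans)
    have ST: "finite (S \<union> T)" "S \<union> T \<subseteq> {p. prime p}" "?e > 0" using S T by auto
    show "\<exists>S e. finite S \<and> S \<subseteq> {p. prime p} \<and> e > 0 \<and> ?N S e \<subseteq> U \<inter> V"
      by (rule exI[of _ "S \<union> T"], rule exI[of _ ?e]) (intro conjI ST sub)
  qed
next
  fix K :: "fin_adele set set" assume K: "\<forall>U\<in>K. open U"
  show "open (\<Union>K)" unfolding open_fin_adele_def
  proof
    fix x assume "x \<in> \<Union>K"
    then obtain U where U: "U \<in> K" "x \<in> U" by blast
    then have "open U" using K by blast
    from this[unfolded open_fin_adele_def, rule_format, OF U(2)]
    obtain S e where S: "finite S" "S \<subseteq> {p. prime p}" "e > 0"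
      and N: "{y. (\<forall>p\<in>S. fin_adele_abs p (y - x) < e) \<and>
         (\<forall>p. prime p \<and> p \<notin> S \<longrightarrow> fin_adele_abs p (y - x) \<le> 1)} \<subseteq> U"
      by (elim exE conjE) (rule that)
    show "\<exists>S e. finite S \<and> S \<subseteq> {p. prime p} \<and> e > 0 \<and>
     {y. (\<forall>p\<in>S. fin_adele_abs p (y - x) < e) \<and>
         (\<forall>p. prime p \<and> p \<notin> S \<longrightarrow> fin_adele_abs p (y - x) \<le> 1)} \<subseteq> \<Union>K"
      by (rule exI[of _ S], rule exI[of _ e]) (intro conjI S order_trans[OF N] Union_upper U(1))
  qed
qed

end

text \<open>Products of rings carry the componentwise multiplication.\<close>

instantiation prod :: (times, times) times
begin
definition times_prod :: "'a \<times> 'b \<Rightarrow> 'a \<times> 'b \<Rightarrow> 'a \<times> 'b" where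
  "times_prod x y = (fst x * fst y, snd x * snd y)"
instance ..
end

instantiation prod :: (one, one) one
begin
definition one_prod :: "'a \<times> 'b" where "one_prod = (1, 1)"
instance ..
end

lemma fst_times_prod [simp]: "fst (x * y) = fst x * fst y"
  and snd_times_prod [simp]: "snd (x * y) = snd x * snd y"
  and fst_one_prod [simp]: "fst 1 = 1"
  and snd_one_prod [simp]: "snd 1 = 1"
  by (simp_all add: times_prod_def one_prod_def)

instance prod :: (comm_ring_1, comm_ring_1) comm_ring_1
  by standard (simp_all add: prod_eq_iff algebra_simps)

type_synonym adele = "fin_adele \<times> real"

definition adele_of_rat :: "rat \<Rightarrow> adele" where
  "adele_of_rat q = (fin_adele_of_rat q, of_rat q)"

lemma adele_of_rat_simps [simp]:
  "adele_of_rat 0 = 0" "adele_of_rat 1 = 1"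
  "adele_of_rat (q + r) = adele_of_rat q + adele_of_rat r"
  "adele_of_rat (q * r) = adele_of_rat q * adele_of_rat r"
proof -
  have "fin_adele_of_rat 0 = 0" "fin_adele_of_rat 1 = 1"
    "fin_adele_of_rat (q + r) = fin_adele_of_rat q + fin_adele_of_rat r"
    "fin_adele_of_rat (q * r) = fin_adele_of_rat q * fin_adele_of_rat r"
    by (transfer; simp add: padics_of_rat_simps)+
  then show "adele_of_rat 0 = 0" "adele_of_rat 1 = 1"
    "adele_of_rat (q + r) = adele_of_rat q + adele_of_rat r"
    "adele_of_rat (q * r) = adele_of_rat q * adele_of_rat r"
    by (simp_all add: prod_eq_iff adele_of_rat_def of_rat_add of_rat_mult)
qed

section \<open>The groups and spaces of two by two matrices\<close>

definition P_bar :: "('a::comm_ring_1 ^ 2 ^ 2) set" where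
  "P_bar = {m. m $ 2 $ 1 = 0 \<and> m $ 2 $ 2 = 1}"

definition P_grp :: "('a::comm_ring_1 ^ 2 ^ 2) monoid" where
  "P_grp = \<lparr>carrier = {m \<in> P_bar. m $ 1 $ 1 dvd 1}, monoid.mult = (**), one = mat 1\<rparr>"

definition GL2 :: "('a::comm_ring_1 ^ 2 ^ 2) monoid" where
  "GL2 = \<lparr>carrier = {m. invertible m}, monoid.mult = (**), one = mat 1\<rparr>"

definition C_units :: "complex monoid" where
  "C_units = \<lparr>carrier = - {0}, monoid.mult = (*), one = 1\<rparr>"

definition cmat :: "complex \<Rightarrow> real ^ 2 ^ 2" where
  "cmat z = vector [vector [Re z, Im z], vector [- Im z, Re z]]"

definition M2_adele_bullet :: "(adele ^ 2 ^ 2) set" where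
  "M2_adele_bullet = {m. map_matrix snd m \<noteq> 0}"

text \<open>An invertible real matrix as an adelic matrix that is trivial at all finite places.\<close>

definition at_infinity_place :: "real ^ 2 ^ 2 \<Rightarrow> adele ^ 2 ^ 2" where
  "at_infinity_place c = (\<chi> i j. (mat 1 $ i $ j, c $ i $ j))"

text \<open>
  The actions below are restricted to the set acted upon, as \<open>group_action\<close> requires.
  Since \<open>C_units\<close> is commutative, its right action is also a left action.
\<close>

definition cx_act :: "complex \<Rightarrow> real ^ 2 ^ 2 \<Rightarrow> real ^ 2 ^ 2" where
  "cx_act z = (\<lambda>m\<in>- {0}. m ** cmat z)"

definition P_act :: "rat ^ 2 ^ 2 \<Rightarrow> adele ^ 2 ^ 2 \<Rightarrow> adele ^ 2 ^ 2" where
  "P_act g = (\<lambda>m\<in>P_bar. map_matrix adele_of_rat g ** m)"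

definition GL2_cx_act :: "(rat ^ 2 ^ 2) \<times> complex \<Rightarrow> adele ^ 2 ^ 2 \<Rightarrow> adele ^ 2 ^ 2" where
  "GL2_cx_act = (\<lambda>(g, z). \<lambda>m\<in>M2_adele_bullet.
     map_matrix adele_of_rat g ** m ** at_infinity_place (cmat z))"

lemma matrix_mult_2: "((A :: 'a::comm_ring_1 ^ 2 ^ 2) ** B) $ i $ j = A $ i $ 1 * B $ 1 $ j + A $ i $ 2 * B $ 2 $ j"
  by (simp add: matrix_matrix_mult_def sum_2)

lemma matrix_eq_2:
  "(A :: 'a ^ 2 ^ 2) = B \<longleftrightarrow> A $ 1 $ 1 = B $ 1 $ 1 \<and> A $ 1 $ 2 = B $ 1 $ 2 \<and>
     A $ 2 $ 1 = B $ 2 $ 1 \<and> A $ 2 $ 2 = B $ 2 $ 2"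
  by (auto simp: vec_eq_iff forall_2)

lemma mat_1_2 [simp]:
  "(mat 1 :: 'a::comm_ring_1 ^ 2 ^ 2) $ 1 $ 1 = 1" "(mat 1 :: 'a ^ 2 ^ 2) $ 1 $ 2 = 0"
  "(mat 1 :: 'a ^ 2 ^ 2) $ 2 $ 1 = 0" "(mat 1 :: 'a ^ 2 ^ 2) $ 2 $ 2 = 1"
  by (simp_all add: mat_def)

lemma P_grp_simps [simp]:
  "carrier P_grp = {m \<in> P_bar. m $ 1 $ 1 dvd 1}" "monoid.mult P_grp = (**)" "one P_grp = mat 1"
  by (simp_all add: P_grp_def)

lemma GL2_simps [simp]:
  "carrier GL2 = {m. invertible m}" "monoid.mult GL2 = (**)" "one GL2 = mat 1"
  by (simp_all add: GL2_def)

lemma C_units_simps [simp]: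
  "carrier C_units = - {0}" "monoid.mult C_units = (*)" "one C_units = 1"
  by (simp_all add: C_units_def)

lemma group_P_grp: "group (P_grp :: ('a::comm_ring_1 ^ 2 ^ 2) monoid)"
proof (rule groupI)
  fix x y :: "'a ^ 2 ^ 2" assume "x \<in> carrier P_grp" "y \<in> carrier P_grp"
  then show "x \<otimes>\<^bsub>P_grp\<^esub> y \<in> carrier P_grp"
    using mult_dvd_mono[of "x $ 1 $ 1" 1 "y $ 1 $ 1" 1] by (simp add: P_bar_def matrix_mult_2)
next
  fix x :: "'a ^ 2 ^ 2" assume x: "x \<in> carrier P_grp"
  then obtain k where k: "1 = x $ 1 $ 1 * k" by (auto simp: dvd_def)
  define y :: "'a ^ 2 ^ 2" where "y = vector [vector [k, - k * x $ 1 $ 2], vector [0, 1]]"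
  have "k dvd 1" using k by (metis dvd_triv_right)
  then have "y \<in> carrier P_grp" "y \<otimes>\<^bsub>P_grp\<^esub> x = \<one>\<^bsub>P_grp\<^esub>"
    using x k by (simp_all add: P_bar_def matrix_mult_2 matrix_eq_2 y_def algebra_simps)
  then show "\<exists>y\<in>carrier P_grp. y \<otimes>\<^bsub>P_grp\<^esub> x = \<one>\<^bsub>P_grp\<^esub>" by blast
qed (simp_all add: P_bar_def matrix_mul_assoc)

lemma group_GL2: "group (GL2 :: ('a::comm_ring_1 ^ 2 ^ 2) monoid)"
proof (rule groupI)
  fix x :: "'a ^ 2 ^ 2" assume "x \<in> carrier GL2"
  then obtain y where "x ** y = mat 1" "y ** x = mat 1" by (auto simp: invertible_def)
  then show "\<exists>y\<in>carrier GL2. y \<otimes>\<^bsub>GL2\<^esub> x = \<one>\<^bsub>GL2\<^esub>"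
    by (intro bexI[of _ y]) (auto simp: invertible_def)
next
  fix x y :: "'a ^ 2 ^ 2" assume "x \<in> carrier GL2" "y \<in> carrier GL2"
  then obtain x' y' where x': "x ** x' = mat 1" "x' ** x = mat 1"
    and y': "y ** y' = mat 1" "y' ** y = mat 1" by (auto simp: invertible_def)
  have "x ** y ** (y' ** x') = x ** (y ** y') ** x'" "y' ** x' ** (x ** y) = y' ** (x' ** x) ** y"
    by (simp_all only: matrix_mul_assoc)
  then have "x ** y ** (y' ** x') = mat 1" "y' ** x' ** (x ** y) = mat 1"
    using x' y' by simp_all
  then show "x \<otimes>\<^bsub>GL2\<^esub> y \<in> carrier GL2"
    by (auto simp: invertible_def)
qed (auto simp: matrix_mul_assoc invertible_def)

lemma group_C_units: "group C_units"
  by (rule groupI) (auto intro!: bexI[of _ "inverse x" for x])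

lemma cmat_nth [simp]:
  "cmat z $ 1 $ 1 = Re z" "cmat z $ 1 $ 2 = Im z" "cmat z $ 2 $ 1 = - Im z" "cmat z $ 2 $ 2 = Re z"
  by (simp_all add: cmat_def)

lemma cmat_simps: "cmat 1 = mat 1" "cmat (z * w) = cmat z ** cmat w"
  by (simp_all add: matrix_eq_2 matrix_mult_2 algebra_simps)

lemma at_infinity_place_simps:
  "at_infinity_place (mat 1) = mat 1"
  "at_infinity_place (c ** d) = at_infinity_place c ** at_infinity_place d"
  by (simp_all add: at_infinity_place_def matrix_eq_2 matrix_mult_2 prod_eq_iff)

lemma map_adele_of_rat_simps:
  "map_matrix adele_of_rat (mat 1 :: rat ^ 2 ^ 2) = mat 1"
  "map_matrix adele_of_rat ((g :: rat ^ 2 ^ 2) ** (h :: rat ^ 2 ^ 2)) =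
     map_matrix adele_of_rat g ** map_matrix adele_of_rat h"
  by (simp_all add: matrix_eq_2 matrix_mult_2)

lemma group_actionI:
  fixes G (structure)
  assumes "group G"
    and closed: "\<And>g x. g \<in> carrier G \<Longrightarrow> x \<in> E \<Longrightarrow> act g x \<in> E"
    and ext: "\<And>g. g \<in> carrier G \<Longrightarrow> act g \<in> extensional E"
    and one: "\<And>x. x \<in> E \<Longrightarrow> act \<one>\<^bsub>G\<^esub> x = x"
    and mult: "\<And>g h x. g \<in> carrier G \<Longrightarrow> h \<in> carrier G \<Longrightarrow> x \<in> E \<Longrightarrow>
       act (g \<otimes>\<^bsub>G\<^esub> h) x = act g (act h x)"
  shows "group_action G E act"
proof -
  interpret group G by fact
  have bij: "act g \<in> Bij E" if g: "g \<in> carrier G" for g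
  proof -
    have "bij_betw (act g) E E"
    proof (rule bij_betwI[where g = "act (inv\<^bsub>G\<^esub> g)"])
      show "act (inv g) (act g x) = x" if "x \<in> E" for x
        using g that mult[of "inv g" g x] one by simp
      show "act g (act (inv g) x) = x" if "x \<in> E" for x
        using g that mult[of g "inv g" x] one by simp
    qed (use g closed in auto)
    then show ?thesis using ext[OF g] by (simp add: Bij_def)
  qed
  have "act \<in> hom G (BijGroup E)"
  proof (rule homI)
    fix g h assume gh: "g \<in> carrier G" "h \<in> carrier G"
    have "act (g \<otimes> h) = compose E (act g) (act h)"
      by (rule extensionalityI[of _ E]) (use gh ext mult in \<open>auto simp: compose_def\<close>)
    then show "act (g \<otimes> h) = act g \<otimes>\<^bsub>BijGroup E\<^esub> act h"
      using bij gh by (simp add: BijGroup_def)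
  qed (simp add: bij BijGroup_def)
  then show ?thesis
    by (simp add: group_action_def group_hom_def group_hom_axioms_def group_BijGroup is_group)
qed

lemma mult_left_mat_eq_0D:
  assumes "invertible g" "g ** m = (0 :: 'a::comm_ring_1 ^ 2 ^ 2)" shows "m = 0"
proof -
  obtain h where "h ** g = mat 1" using assms(1) by (auto simp: invertible_def)
  then have "m = h ** (g ** m)" by (simp add: matrix_mul_assoc)
  then show ?thesis using assms(2) by (simp add: matrix_eq_2 matrix_mult_2)
qed

lemma mult_right_cmat_eq_0D:
  assumes "z \<noteq> 0" "m ** cmat z = 0" shows "m = 0"
proof -
  have "m = m ** cmat z ** cmat (inverse z)"
  proof -
    have "cmat z ** cmat (inverse z) = mat 1"
      using assms(1) cmat_simps(2)[of z "inverse z"] by (simp add: cmat_simps(1))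
    then show ?thesis by (simp add: matrix_mul_assoc[symmetric])
  qed
  then show ?thesis using assms(2) by (simp add: matrix_eq_2 matrix_mult_2)
qed

lemma cx_action: "group_action C_units (- {0}) cx_act"
proof (rule group_actionI)
  show "cx_act g x \<in> - {0}" if "g \<in> carrier C_units" "x \<in> - {0}" for g x
    using that mult_right_cmat_eq_0D[of g x] by (auto simp: cx_act_def)
  then show "cx_act (g \<otimes>\<^bsub>C_units\<^esub> h) x = cx_act g (cx_act h x)"
    if "g \<in> carrier C_units" "h \<in> carrier C_units" "x \<in> - {0}" for g h x
    using that mult_right_cmat_eq_0D[of h x]
    by (simp add: cx_act_def mult.commute[of g h] cmat_simps matrix_mul_assoc)
qed (auto simp: group_C_units cx_act_def cmat_simps)

lemma P_action: "group_action P_grp P_bar P_act"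
proof (rule group_actionI)
  show "P_act \<one>\<^bsub>P_grp\<^esub> x = x" if "x \<in> P_bar" for x
    using that by (simp add: P_act_def map_adele_of_rat_simps)
  have closed: "map_matrix adele_of_rat g ** x \<in> P_bar"
    if "g \<in> carrier P_grp" "x \<in> P_bar" for g x
    using that by (simp add: P_bar_def matrix_mult_2)
  then show "P_act g x \<in> P_bar" if "g \<in> carrier P_grp" "x \<in> P_bar" for g x
    using that by (simp add: P_act_def)
  show "P_act (g \<otimes>\<^bsub>P_grp\<^esub> h) x = P_act g (P_act h x)"
    if "g \<in> carrier P_grp" "h \<in> carrier P_grp" "x \<in> P_bar" for g h x
    using that closed[of h x]
    by (simp add: P_act_def map_adele_of_rat_simps matrix_mul_assoc)
qed (simp_all add: group_P_grp P_act_def)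

lemma GL2_cx_action: "group_action (GL2 \<times>\<times> C_units) M2_adele_bullet GL2_cx_act"
proof (rule group_actionI)
  show "GL2_cx_act \<one>\<^bsub>GL2 \<times>\<times> C_units\<^esub> x = x" if "x \<in> M2_adele_bullet" for x
    using that by (simp add: GL2_cx_act_def map_adele_of_rat_simps cmat_simps at_infinity_place_simps)
  have closed: "map_matrix adele_of_rat g ** x ** at_infinity_place (cmat z) \<in> M2_adele_bullet"
    if g: "invertible g" and z: "z \<noteq> 0" and x: "x \<in> M2_adele_bullet" for g z x
  proof -
    let ?g = "map_matrix of_rat g :: real ^ 2 ^ 2"
    have mult: "map_matrix of_rat (a ** b) = (map_matrix of_rat a ** map_matrix of_rat b :: real ^ 2 ^ 2)"
      for a b :: "rat ^ 2 ^ 2"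
      by (simp add: matrix_eq_2 matrix_mult_2 of_rat_add of_rat_mult)
    have one: "map_matrix of_rat (mat 1 :: rat ^ 2 ^ 2) = (mat 1 :: real ^ 2 ^ 2)"
      by (simp add: matrix_eq_2)
    have inv: "invertible ?g"
      using g unfolding invertible_def by (metis mult one)
    have "map_matrix snd (map_matrix adele_of_rat g ** x ** at_infinity_place (cmat z))
        = ?g ** map_matrix snd x ** cmat z"
      by (simp add: matrix_eq_2 matrix_mult_2 adele_of_rat_def at_infinity_place_def)
    then show ?thesis
      using x mult_right_cmat_eq_0D[OF z] mult_left_mat_eq_0D[OF inv]
      by (auto simp: M2_adele_bullet_def)
  qed
  then show "GL2_cx_act g x \<in> M2_adele_bullet"
    if "g \<in> carrier (GL2 \<times>\<times> C_units)" "x \<in> M2_adele_bullet" for g x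
    using that closed[of "fst g" "snd g" x] by (cases g) (simp add: GL2_cx_act_def)
  show "GL2_cx_act (g \<otimes>\<^bsub>GL2 \<times>\<times> C_units\<^esub> h) x = GL2_cx_act g (GL2_cx_act h x)"
    if "g \<in> carrier (GL2 \<times>\<times> C_units)" "h \<in> carrier (GL2 \<times>\<times> C_units)"
      "x \<in> M2_adele_bullet" for g h x
  proof -
    obtain a z b w where gh: "g = (a, z)" "h = (b, w)" by (cases g, cases h)
    show ?thesis
      using that closed[of b w x] unfolding gh
      by (simp add: GL2_cx_act_def map_adele_of_rat_simps mult.commute[of z w] cmat_simps
          at_infinity_place_simps matrix_mul_assoc)
  qed
qed (auto simp: DirProd_group group_GL2 group_C_units GL2_cx_act_def split: prod.splits)

section \<open>Orbit spaces\<close>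

text \<open>The set of orbits with the quotient topology.\<close>

definition orbit_space ::
  "('g, 'h) monoid_scheme \<Rightarrow> 'a::topological_space set \<Rightarrow> ('g \<Rightarrow> 'a \<Rightarrow> 'a) \<Rightarrow> 'a set topology"
where
  "orbit_space G X act = topology (\<lambda>U. U \<subseteq> orbits G X act \<and>
     openin (top_of_set X) {x \<in> X. orbit G act x \<in> U})"

lemma openin_orbit_space:
  "openin (orbit_space G X act) U \<longleftrightarrow>
     U \<subseteq> orbits G X act \<and> openin (top_of_set X) {x \<in> X. orbit G act x \<in> U}"
proof -
  have "istopology (\<lambda>U. U \<subseteq> orbits G X act \<and>
     openin (top_of_set X) {x \<in> X. orbit G act x \<in> U})"
    unfolding istopology_def
  proof (intro conjI allI impI)
    fix S T assume *: "S \<subseteq> orbits G X act \<and> openin (top_of_set X) {x \<in> X. orbit G act x \<in> S}"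
      "T \<subseteq> orbits G X act \<and> openin (top_of_set X) {x \<in> X. orbit G act x \<in> T}"
    have "{x \<in> X. orbit G act x \<in> S \<inter> T} =
        {x \<in> X. orbit G act x \<in> S} \<inter> {x \<in> X. orbit G act x \<in> T}" by auto
    then show "openin (top_of_set X) {x \<in> X. orbit G act x \<in> S \<inter> T}"
      using * by (simp only:) (blast intro: openin_Int)
    show "S \<inter> T \<subseteq> orbits G X act" using * by auto
  next
    fix K assume *: "\<forall>U\<in>K. U \<subseteq> orbits G X act \<and>
      openin (top_of_set X) {x \<in> X. orbit G act x \<in> U}"
    have "{x \<in> X. orbit G act x \<in> \<Union>K} = (\<Union>U\<in>K. {x \<in> X. orbit G act x \<in> U})" by auto
    then show "openin (top_of_set X) {x \<in> X. orbit G act x \<in> \<Union>K}"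
      using * by (simp only:) (intro openin_Union, auto)
    show "\<Union>K \<subseteq> orbits G X act" using * by auto
  qed
  then show ?thesis unfolding orbit_space_def by (simp add: topology_inverse')
qed

lemma topspace_orbit_space [simp]: "topspace (orbit_space G X act) = orbits G X act"
proof -
  have "{x \<in> X. orbit G act x \<in> orbits G X act} = X" by (auto simp: orbits_def)
  then have "openin (orbit_space G X act) (orbits G X act)"
    by (simp add: openin_orbit_space)
  then show ?thesis
    by (metis openin_orbit_space openin_subset openin_topspace subset_antisym)
qed

definition infinity_pt :: "(real ^ 2 ^ 2) set" where
  "infinity_pt = {m. m \<noteq> 0 \<and> m $ 2 = 0}"

definition C_Q :: "(adele ^ 2 ^ 2) set topology" where
  "C_Q = orbit_space P_grp P_bar P_act"

text \<open>The double quotient, as the orbit space of the product group, the two actions commuting.\<close>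

definition Sh_nc_bar :: "(adele ^ 2 ^ 2) set topology" where
  "Sh_nc_bar = orbit_space (GL2 \<times>\<times> C_units) M2_adele_bullet GL2_cx_act"

end

theory Submission
  imports Defs
begin

text \<open>
  A row \<open>(c, d)\<close> of a real matrix is the complex number \<open>w = c + i d\<close>, and right multiplication
  by \<open>cmat z\<close> replaces each row \<open>w\<close> by \<open>w z\<close>. A real matrix is therefore a pair of complex numbers
  on which \<open>z\<close> acts by simultaneous scaling, and the orbit space of the nonzero matrices is the
  complex projective line. The matrices in \<open>P_bar\<close> are the pairs with second entry \<open>\<i>\<close>: the usual
  affine chart. Any nonzero second entry \<open>w\<close> is moved to \<open>\<i>\<close> by exactly one scalar, namely
  \<open>\<i> / w\<close>, whence the bijection of part (i); the pairs with second entry \<open>0\<close> form the single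
  remaining point.

  Part (ii) is an instance of a general principle (\<open>unique_induced_map_orbit_spaces\<close>): a continuous
  map that is equivariant along a map of groups descends to a unique continuous map of orbit spaces.
  Here the continuous map is an inclusion and the map of groups sends \<open>g\<close> to \<open>(g, 1)\<close>; it is a
  homomorphism into \<open>GL2 \<times>\<times> C_units\<close> because an affine matrix whose upper left entry is a unit is
  invertible, and equivariance holds because \<open>1\<close> acts trivially at the archimedean place.
\<close>

lemma orbit_eq:
  assumes "group_action G E act" "x \<in> E" "y \<in> orbit G act x"
  shows "orbit G act y = orbit G act x"
proof -
  interpret group_action G E act by fact
  have y: "y \<in> E" using assms(2,3) element_image unfolding orbit_def by blast
  have "y \<in> orbit G act y" using orbit_refl y by blast
  then show ?thesis
    using disjoint_union[of "orbit G act x" "orbit G act y"] assms(2,3) y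
    unfolding orbits_def by blast
qed

text \<open>
  Equivariance carries each orbit of \<open>X\<close> into one orbit of \<open>Y\<close>. Continuity holds because, when a
  set of orbits of \<open>Y\<close> is pulled back to \<open>X\<close>, going through the orbits of \<open>X\<close> gives the same set
  as going through \<open>Y\<close>, and there it is the preimage under \<open>f\<close> of a set open in \<open>Y\<close>. The conditions
  leave no freedom, since every point of the source is the orbit of some point of \<open>X\<close>.
\<close>

lemma unique_induced_map_orbit_spaces:
  assumes G: "group_action G X act" and H: "group_action H Y act'"
    and hom: "\<And>g. g \<in> carrier G \<Longrightarrow> j g \<in> carrier H"
    and f: "f \<in> X \<rightarrow> Y" "continuous_on X f"
    and equivariant: "\<And>g x. g \<in> carrier G \<Longrightarrow> x \<in> X \<Longrightarrow> f (act g x) = act' (j g) (f x)"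
  shows "\<exists>!\<theta>. \<theta> \<in> extensional (topspace (orbit_space G X act)) \<and>
    continuous_map (orbit_space G X act) (orbit_space H Y act') \<theta> \<and>
    (\<forall>x\<in>X. \<theta> (orbit G act x) = orbit H act' (f x))"
proof (rule ex1I)
  \<comment> \<open>The union avoids choosing a representative: all its members are equal.\<close>
  let ?\<theta> = "\<lambda>c\<in>orbits G X act. \<Union>x\<in>c. orbit H act' (f x)"
  have val: "?\<theta> (orbit G act x) = orbit H act' (f x)" if x: "x \<in> X" for x
  proof -
    have "orbit H act' (f y) = orbit H act' (f x)" if y: "y \<in> orbit G act x" for y
    proof -
      obtain g where g: "g \<in> carrier G" "y = act g x" using y by (auto simp: orbit_def)
      have "f y \<in> orbit H act' (f x)"
        unfolding orbit_def g(2) equivariant[OF g(1) x] using hom[OF g(1)] by blast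
      then show ?thesis by (rule orbit_eq[OF H funcset_mem[OF f(1) x]])
    qed
    moreover have "x \<in> orbit G act x" using group_action.orbit_refl[OF G x] .
    ultimately have "(\<Union>y\<in>orbit G act x. orbit H act' (f y)) = orbit H act' (f x)" by blast
    moreover have "orbit G act x \<in> orbits G X act" using x unfolding orbits_def by blast
    ultimately show ?thesis by simp
  qed
  have "continuous_map (orbit_space G X act) (orbit_space H Y act') ?\<theta>"
    unfolding continuous_map_def topspace_orbit_space
  proof (intro conjI allI impI)
    show "?\<theta> \<in> orbits G X act \<rightarrow> orbits H Y act'"
    proof (rule Pi_I)
      fix c assume "c \<in> orbits G X act"
      then obtain x where x: "x \<in> X" "c = orbit G act x" by (auto simp: orbits_def)
      then show "?\<theta> c \<in> orbits H Y act'"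
        unfolding x(2) val[OF x(1)] using funcset_mem[OF f(1)] unfolding orbits_def by blast
    qed
    fix U assume "openin (orbit_space H Y act') U"
    then have "openin (top_of_set Y) {y \<in> Y. orbit H act' y \<in> U}"
      by (simp add: openin_orbit_space)
    then have "openin (top_of_set X) (X \<inter> f -` {y \<in> Y. orbit H act' y \<in> U})"
      by (rule continuous_openin_preimage[OF f(2) f(1)])
    moreover have "{x \<in> X. orbit G act x \<in> {c \<in> orbits G X act. ?\<theta> c \<in> U}} =
        X \<inter> f -` {y \<in> Y. orbit H act' y \<in> U}"
    proof -
      have "orbit G act x \<in> {c \<in> orbits G X act. ?\<theta> c \<in> U} \<longleftrightarrow>
          f x \<in> {y \<in> Y. orbit H act' y \<in> U}" if x: "x \<in> X" for x
      proof -
        have "orbit G act x \<in> orbits G X act" using x by (auto simp: orbits_def)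
        then show ?thesis unfolding mem_Collect_eq val[OF x] using funcset_mem[OF f(1) x] by simp
      qed
      then show ?thesis by blast
    qed
    ultimately show "openin (orbit_space G X act) {c \<in> orbits G X act. ?\<theta> c \<in> U}"
      unfolding openin_orbit_space by simp
  qed
  then show "?\<theta> \<in> extensional (topspace (orbit_space G X act)) \<and>
    continuous_map (orbit_space G X act) (orbit_space H Y act') ?\<theta> \<and>
    (\<forall>x\<in>X. ?\<theta> (orbit G act x) = orbit H act' (f x))"
    using val by simp
  fix \<eta> assume \<eta>: "\<eta> \<in> extensional (topspace (orbit_space G X act)) \<and>
    continuous_map (orbit_space G X act) (orbit_space H Y act') \<eta> \<and>
    (\<forall>x\<in>X. \<eta> (orbit G act x) = orbit H act' (f x))"
  show "\<eta> = ?\<theta>"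
  proof (rule extensionalityI)
    fix c assume "c \<in> orbits G X act"
    then obtain x where "x \<in> X" "c = orbit G act x" by (auto simp: orbits_def)
    then show "\<eta> c = ?\<theta> c" using \<eta> val by metis
  qed (use \<eta> in simp_all)
qed

text \<open>Row \<open>k\<close> of a real matrix as a complex number; it turns the action of \<open>C_units\<close> into scaling.\<close>

definition row_cx :: "real ^ 2 ^ 2 \<Rightarrow> 2 \<Rightarrow> complex" where
  "row_cx m k = Complex (m $ k $ 1) (m $ k $ 2)"

lemma row_cx_mult_cmat: "row_cx (m ** cmat z) k = row_cx m k * z"
  by (simp add: row_cx_def matrix_mult_2 complex_eq_iff)

lemma matrix_eq_row_cx: "m = n \<longleftrightarrow> row_cx m 1 = row_cx n 1 \<and> row_cx m 2 = row_cx n 2"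
  by (auto simp: row_cx_def matrix_eq_2)

lemma P_bar_iff_row_cx: "m \<in> P_bar \<longleftrightarrow> row_cx m 2 = \<i>"
  by (simp add: P_bar_def row_cx_def complex_eq_iff)

lemma infinity_pt_iff_row_cx: "m \<in> infinity_pt \<longleftrightarrow> m \<noteq> 0 \<and> row_cx m 2 = 0"
  by (auto simp: infinity_pt_def row_cx_def complex_eq_iff vec_eq_iff forall_2)

lemma row_cx_zero: "row_cx 0 k = 0"
  by (simp add: row_cx_def complex_eq_iff)

lemma P_bar_nonzero: "(P_bar :: (real ^ 2 ^ 2) set) \<subseteq> - {0}"
  by (auto simp: P_bar_def)

lemma mem_cx_orbit_iff:
  assumes "m \<noteq> 0"
  shows "n \<in> orbit C_units cx_act m \<longleftrightarrow> (\<exists>z. z \<noteq> 0 \<and> n = m ** cmat z)"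
  using assms by (auto simp: orbit_def cx_act_def)

text \<open>Two nonzero numbers differ by a scalar, so the pairs \<open>(w, 0)\<close> with \<open>w\<close> nonzero
  are one orbit, that of the pair \<open>(1, 0)\<close>.\<close>

lemma infinity_pt_orbit: "infinity_pt \<in> orbits C_units (- {0}) cx_act"
proof -
  define e :: "real ^ 2 ^ 2" where "e = vector [vector [1, 0], vector [0, 0]]"
  have e: "row_cx e 1 = 1" "row_cx e 2 = 0"
    by (simp_all add: e_def row_cx_def complex_eq_iff)
  then have e0: "e \<noteq> 0" using row_cx_zero[of 1] by auto
  have "n \<in> infinity_pt \<longleftrightarrow> n \<in> orbit C_units cx_act e" for n
    unfolding mem_cx_orbit_iff[OF e0] infinity_pt_iff_row_cx
    using e by (auto simp: matrix_eq_row_cx row_cx_mult_cmat row_cx_zero)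
  then have "infinity_pt = orbit C_units cx_act e" by blast
  then show ?thesis using e0 by (auto simp: orbits_def)
qed

text \<open>Scaling does not affect whether the second row vanishes, so the orbits other than
  \<open>infinity_pt\<close> are those of pairs with second entry \<open>w\<close> nonzero; scaling by \<open>\<i> / w\<close> leads
  into \<open>P_bar\<close>. Only \<open>z = 1\<close> satisfies \<open>\<i> z = \<i>\<close>, so no orbit meets \<open>P_bar\<close> twice.\<close>

lemma bij_betw_P_bar_orbits:
  "bij_betw (orbit C_units cx_act) P_bar (orbits C_units (- {0}) cx_act - {infinity_pt})"
proof (rule bij_betw_imageI)
  have refl: "m \<in> orbit C_units cx_act m" if "m \<noteq> 0" for m
    using group_action.orbit_refl[OF cx_action] that by simp
  show "inj_on (orbit C_units cx_act) P_bar"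
  proof (rule inj_onI)
    fix m n :: "real ^ 2 ^ 2"
    assume mn: "m \<in> P_bar" "n \<in> P_bar"
      and eq: "orbit C_units cx_act m = orbit C_units cx_act n"
    have nz: "m \<noteq> 0" "n \<noteq> 0" using mn P_bar_nonzero by auto
    obtain z where z: "n = m ** cmat z" using refl[OF nz(2)] eq mem_cx_orbit_iff[OF nz(1)] by blast
    have "\<i> = \<i> * z" using mn z by (metis P_bar_iff_row_cx row_cx_mult_cmat)
    then have "z = 1" by simp
    then show "m = n" using z by (simp add: cmat_simps)
  qed
  show "orbit C_units cx_act ` P_bar = orbits C_units (- {0}) cx_act - {infinity_pt}"
  proof (intro equalityI subsetI)
    fix c assume "c \<in> orbit C_units cx_act ` P_bar"
    then obtain m where m: "m \<in> P_bar" "c = orbit C_units cx_act m" by blast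
    then have nz: "m \<noteq> 0" using P_bar_nonzero by auto
    have "m \<notin> infinity_pt" using m by (simp add: P_bar_iff_row_cx infinity_pt_iff_row_cx)
    then have "c \<noteq> infinity_pt" using refl[OF nz] m by blast
    then show "c \<in> orbits C_units (- {0}) cx_act - {infinity_pt}"
      using m nz by (auto simp: orbits_def)
  next
    fix c assume c: "c \<in> orbits C_units (- {0}) cx_act - {infinity_pt}"
    then obtain m where m: "m \<noteq> 0" "c = orbit C_units cx_act m" by (auto simp: orbits_def)
    have w: "row_cx m 2 \<noteq> 0"
    proof
      assume "row_cx m 2 = 0"
      then have "m \<in> infinity_pt" using m by (simp add: infinity_pt_iff_row_cx)
      then have "infinity_pt \<inter> c \<noteq> {}" using refl m by blast
      then show False
        using group_action.disjoint_union[OF cx_action infinity_pt_orbit] c by blast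
    qed
    define n where "n = m ** cmat (\<i> / row_cx m 2)"
    have "n \<in> P_bar" using w by (simp add: n_def P_bar_iff_row_cx row_cx_mult_cmat)
    moreover have "n \<in> orbit C_units cx_act m"
      unfolding mem_cx_orbit_iff[OF m(1)] n_def using w
      by (intro exI[of _ "\<i> / row_cx m 2"]) simp
    then have "orbit C_units cx_act n = c" using orbit_eq[OF cx_action] m by simp
    ultimately show "c \<in> orbit C_units cx_act ` P_bar" by blast
  qed
qed

lemma invertible_if_P_grp:
  assumes "g \<in> carrier P_grp" shows "invertible g"
proof -
  interpret group P_grp by (rule group_P_grp)
  show ?thesis using l_inv[OF assms] r_inv[OF assms] unfolding invertible_def by auto
qed

lemma P_grp_embedding_hom: "(\<lambda>g. (g, 1)) \<in> hom P_grp (GL2 \<times>\<times> C_units)"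
  using invertible_if_P_grp by (auto simp: hom_def)

lemma P_bar_subset_M2_adele_bullet: "P_bar \<subseteq> M2_adele_bullet"
  by (auto simp: P_bar_def M2_adele_bullet_def vec_eq_iff forall_2)

lemma P_act_eq_GL2_cx_act:
  assumes "m \<in> P_bar" shows "P_act g m = GL2_cx_act (g, 1) m"
  using assms P_bar_subset_M2_adele_bullet
  by (auto simp: P_act_def GL2_cx_act_def cmat_simps at_infinity_place_simps)

theorem lemma6p1:
  shows
    "((P_bar :: (real ^ 2 ^ 2) set) \<subseteq> - {0} \<and>
      infinity_pt \<in> orbits C_units (- {0}) cx_act \<and>
      bij_betw (orbit C_units cx_act) P_bar
        (orbits C_units (- {0}) cx_act - {infinity_pt})) \<and>
     (P_bar \<subseteq> M2_adele_bullet \<and>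
      (\<lambda>g :: rat ^ 2 ^ 2. (g, 1)) \<in> hom P_grp (GL2 \<times>\<times> C_units) \<and>
      (\<forall>g\<in>carrier P_grp. \<forall>m\<in>P_bar. P_act g m = GL2_cx_act (g, 1) m) \<and>
      (\<exists>!\<theta>. \<theta> \<in> extensional (topspace C_Q) \<and>
         continuous_map C_Q Sh_nc_bar \<theta> \<and>
         (\<forall>m\<in>P_bar. \<theta> (orbit P_grp P_act m) =
            orbit (GL2 \<times>\<times> C_units) GL2_cx_act m)))"
proof (intro conjI ballI)
  show "\<exists>!\<theta>. \<theta> \<in> extensional (topspace C_Q) \<and>
      continuous_map C_Q Sh_nc_bar \<theta> \<and>
      (\<forall>m\<in>P_bar. \<theta> (orbit P_grp P_act m) = orbit (GL2 \<times>\<times> C_units) GL2_cx_act m)"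
    unfolding C_Q_def Sh_nc_bar_def
  proof (rule unique_induced_map_orbit_spaces[OF P_action GL2_cx_action])
    show "(g, 1) \<in> carrier (GL2 \<times>\<times> C_units)" if "g \<in> carrier P_grp" for g :: "rat ^ 2 ^ 2"
      using P_grp_embedding_hom that by (auto simp: hom_def)
  qed (use P_bar_subset_M2_adele_bullet P_act_eq_GL2_cx_act in auto)
qed (use P_bar_nonzero infinity_pt_orbit bij_betw_P_bar_orbits P_bar_subset_M2_adele_bullet
    P_grp_embedding_hom P_act_eq_GL2_cx_act in auto)

end
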